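(* The K-shell protocol (written out in the context) takes $$\mathcal{O}\left((n+m)\left(f(n)+f(m)\right)+n(\log (n))^2\right)$$ time complexity (in terms of the number of primitive operations used), where $f(n)$ denotes the overhead for reading/writing to an element of an ORAM array of size $n$.
   Context: **Graphs and representation.** $G(V,E)$ is a graph with vertex set $V=\{1,\dots,n\}$ and $m=|E|$ edges; edges are directed (ordered pairs of vertices), an undirected graph being included as a graph with bidirectional edges. The input is given in the edgelist representation $(\mathcal{E},Idx)$. $\mathcal{E}$ is an array of length $m+1$ containing the concatenated adjacency lists of all vertices (in the order $1,2,\dots,n$) and an empty element at the end. $Idx$ is an array of length $n$: $Idx[u]=i$ if out-degree$(u)\neq 0$ and $\mathcal{E}[i]$ is the first neighbour of $u$ in $\mathcal{E}$; $Idx[u]=Idx[u+1]$ if $u\neq n$ and out-degree$(u)=0$; $Idx[u]=m+1$ if $u=n$ and out-degree$(u)=0$. Convention: $Idx[n+1]=m+1$. **Cost model.** Efficiency is measured by the number of primitive operations; addition, subtraction, multiplication, division, comparison and equality check are primitive operations. The arrays $deg,bin,vert,pos,\mathcal{E},Idx$ are stored in an Oblivious RAM (ORAM), which allows array accesses at secret indices; $f(n)$ is the number of primitive operations employed for reading/writing an element in an ORAM array of size $n$. The if-else construct is executed by running both branches one after the other, one of them in a dummy fashion. Oblivious sorting of $n$ elements is assumed to cost $\mathcal{O}(n(\log (n))^2)$. **The K-shell protocol.** Input: $(\mathcal{E},Idx)$. Output: the shell number of each $v\in V$ (the $i$ such that $v$ is in the $i$-core but not in the $(i+1)$-core, the $k$-core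 being the subgraph induced by the largest vertex set in which every vertex has degree at least $k$ within that subgraph), namely the final value $deg[v]$. 1. $deg[i]\leftarrow 0$ for $1\le i\le n$; $vert[i]\leftarrow i$ for $1\le i\le n$; $bin[i]\leftarrow 0$ for $1\le i\le n-1$. 2. For $i=1$ to $n$: $deg[i]\leftarrow Idx[i+1]-Idx[i]$; $bin[deg[i]]\leftarrow bin[deg[i]]+1$. 3. $start\leftarrow 1$. For $i=1$ to $n$: $temp\leftarrow bin[i]$; $bin[i]\leftarrow start$; $start\leftarrow start+temp$. 4. Sort $vert$ with respect to the degrees $deg$ (by the oblivious sorting primitive). Set $pos[vert[i]]\leftarrow i$ for $1\le i\le n$. 5. $i\leftarrow 1$; $v\leftarrow vert[i]$; $j\leftarrow Idx[v]$. 6. For $iter=1$ to $n+m-1$: - If $j==Idx[v+1]$: $i\leftarrow i+1$; $v\leftarrow vert[i]$; $j\leftarrow Idx[v]$. - Else: $u\leftarrow\mathcal{E}[j]$. If $deg[u]>deg[v]$: { $du\leftarrow deg[u]$; $pu\leftarrow pos[u]$; $pw\leftarrow bin[du]$; $w\leftarrow vert[pw]$; if $u\neq w$: { $pos[u]\leftarrow pw$; $vert[pu]\leftarrow w$; $pos[w]\leftarrow pu$; $vert[pw]\leftarrow u$ }; $bin[du]\leftarrow bin[du]+1$; $deg[u]\leftarrow deg[u]-1$ }. Then (still in the else branch) $j\leftarrow j+1$.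
   Formalization: The overhead f is additionally assumed to satisfy f(k+1) = O(f(k)), since the array E has length m+1; without this the bound fails, e.g. for f(k) = k! on directed cycles with n = m. *)

theory Defs
  imports "Graph_Theory.Pair_Digraph" "HOL-Library.Landau_Symbols"
begin

datatype arr = Deg | Bin | Vert | Pos | Edges | Idx

datatype var = I | V | J | U | DU | PU | PW | W | Temp | Start | Iter

datatype expr =
    Const nat
  | Var var
  | Read arr expr
  | Add expr expr
  | Sub expr expr

datatype test =
    Equal expr expr
  | Less expr expr

text \<open>
  \<open>For x a b c\<close> runs \<open>c\<close> for \<open>x = a, \<dots>, b\<close>; the bounds are public numbers.
  \<open>Sort k A K\<close> sorts the entries \<open>1, \<dots>, k\<close> of the array \<open>A\<close>, where the key of a value \<open>v\<close> is
  entry \<open>v\<close> of the array \<open>K\<close>.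
\<close>
datatype com =
    Skip
  | Assign var expr
  | Write arr expr expr
  | Seq com com  (infixr \<open>;;\<close> 60)
  | If test com com
  | For var nat nat com
  | Sort nat arr arr

text \<open>
  Arrays are total functions, addressed from 1 as in the protocol. Allocated lengths enter only
  through the access costs.
\<close>
record state =
  mem :: "arr \<Rightarrow> nat \<Rightarrow> nat"
  reg :: "var \<Rightarrow> nat"

text \<open>
  Subtraction is truncated; the subtractions of the protocol that have an effect never are, because
  the index array is nondecreasing and \<open>deg[u]\<close> is decremented only if \<open>deg[u] > deg[v]\<close>.
\<close>
primrec eval_expr :: "expr \<Rightarrow> state \<Rightarrow> nat" where
  "eval_expr (Const k) s = k"
| "eval_expr (Var x) s = reg s x"
| "eval_expr (Read A e) s = mem s A (eval_expr e s)"
| "eval_expr (Add e1 e2) s = eval_expr e1 s + eval_expr e2 s"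
| "eval_expr (Sub e1 e2) s = eval_expr e1 s - eval_expr e2 s"

primrec eval_test :: "test \<Rightarrow> state \<Rightarrow> bool" where
  "eval_test (Equal e1 e2) s \<longleftrightarrow> eval_expr e1 s = eval_expr e2 s"
| "eval_test (Less e1 e2) s \<longleftrightarrow> eval_expr e1 s < eval_expr e2 s"

text \<open>
  \<open>ac A\<close> is the number of primitive operations for one access to the array \<open>A\<close>. Every arithmetic
  operation and every test is one primitive operation.
\<close>
primrec cost_expr :: "(arr \<Rightarrow> nat) \<Rightarrow> expr \<Rightarrow> nat" where
  "cost_expr ac (Const k) = 0"
| "cost_expr ac (Var x) = 0"
| "cost_expr ac (Read A e) = cost_expr ac e + ac A"
| "cost_expr ac (Add e1 e2) = cost_expr ac e1 + cost_expr ac e2 + 1"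
| "cost_expr ac (Sub e1 e2) = cost_expr ac e1 + cost_expr ac e2 + 1"

primrec cost_test :: "(arr \<Rightarrow> nat) \<Rightarrow> test \<Rightarrow> nat" where
  "cost_test ac (Equal e1 e2) = cost_expr ac e1 + cost_expr ac e2 + 1"
| "cost_test ac (Less e1 e2) = cost_expr ac e1 + cost_expr ac e2 + 1"

type_synonym sorter = "(nat \<Rightarrow> nat) \<Rightarrow> nat list \<Rightarrow> nat list"

text \<open>No stability is required: ties may be broken in any way.\<close>
definition is_sorter :: "sorter \<Rightarrow> bool" where
  "is_sorter srt \<longleftrightarrow>
     (\<forall>key xs. mset (srt key xs) = mset xs \<and> sorted (map key (srt key xs)))"

definition store_list :: "nat list \<Rightarrow> (nat \<Rightarrow> nat) \<Rightarrow> nat \<Rightarrow> nat" where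
  "store_list xs a = (\<lambda>i. if 1 \<le> i \<and> i \<le> length xs then xs ! (i - 1) else a i)"

text \<open>
  \<open>exec ac sc srt c act s\<close> is the final state together with the number of primitive operations
  used; \<open>sc k\<close> is the cost of sorting \<open>k\<close> elements. If the flag \<open>act\<close> is false, then \<open>c\<close> is a dummy
  run: all operations are carried out and paid for, but without effect on the state. A conditional
  runs both branches, exactly one of them as a dummy (both, if it is itself part of a dummy run).
  Each loop iteration pays 2 for incrementing the counter and comparing it with the bound.
\<close>
primrec exec ::
  "(arr \<Rightarrow> nat) \<Rightarrow> (nat \<Rightarrow> nat) \<Rightarrow> sorter \<Rightarrow> com \<Rightarrow> bool \<Rightarrow> state \<Rightarrow> state \<times> nat"
where
  "exec ac sc srt Skip act s = (s, 0)"
| "exec ac sc srt (Assign x e) act s =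
     (if act then s\<lparr>reg := (reg s)(x := eval_expr e s)\<rparr> else s,
      cost_expr ac e)"
| "exec ac sc srt (Write A i e) act s =
     (if act
      then s\<lparr>mem := (mem s)(A := (mem s A)(eval_expr i s := eval_expr e s))\<rparr>
      else s,
      cost_expr ac i + cost_expr ac e + ac A)"
| "exec ac sc srt (Seq c1 c2) act s =
     (let (s1, t1) = exec ac sc srt c1 act s;
          (s2, t2) = exec ac sc srt c2 act s1
      in (s2, t1 + t2))"
| "exec ac sc srt (If b c1 c2) act s =
     (let (s1, t1) = exec ac sc srt c1 (act \<and> eval_test b s) s;
          (s2, t2) = exec ac sc srt c2 (act \<and> \<not> eval_test b s) s1
      in (s2, cost_test ac b + t1 + t2))"
| "exec ac sc srt (For x a b c) act s =
     fold (\<lambda>k (s1, t1).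
             let (s2, t2) =
               exec ac sc srt c act (if act then s1\<lparr>reg := (reg s1)(x := k)\<rparr> else s1)
             in (s2, t1 + t2 + 2))
       [a..<b + 1] (s, 0)"
| "exec ac sc srt (Sort k A K) act s =
     (if act
      then s\<lparr>mem := (mem s)
               (A := store_list (srt (mem s K) (map (mem s A) [1..<k + 1])) (mem s A))\<rparr>
      else s,
      sc k)"

definition kshell_init :: "nat \<Rightarrow> com" where
  "kshell_init n =
     For I 1 n (Write Deg (Var I) (Const 0)) ;;
     For I 1 n (Write Vert (Var I) (Var I)) ;;
     For I 1 (n - 1) (Write Bin (Var I) (Const 0))"

definition kshell_degrees :: "nat \<Rightarrow> com" where
  "kshell_degrees n =
     For I 1 n
      (Write Deg (Var I) (Sub (Read Idx (Add (Var I) (Const 1))) (Read Idx (Var I))) ;;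
       Write Bin (Read Deg (Var I)) (Add (Read Bin (Read Deg (Var I))) (Const 1)))"

definition kshell_bins :: "nat \<Rightarrow> com" where
  "kshell_bins n =
     Assign Start (Const 1) ;;
     For I 1 n
      (Assign Temp (Read Bin (Var I)) ;;
       Write Bin (Var I) (Var Start) ;;
       Assign Start (Add (Var Start) (Var Temp)))"

definition kshell_sort :: "nat \<Rightarrow> com" where
  "kshell_sort n =
     Sort n Vert Deg ;;
     For I 1 n (Write Pos (Read Vert (Var I)) (Var I))"

definition kshell_decrement :: com where
  "kshell_decrement =
     Assign DU (Read Deg (Var U)) ;;
     Assign PU (Read Pos (Var U)) ;;
     Assign PW (Read Bin (Var DU)) ;;
     Assign W (Read Vert (Var PW)) ;;
     If (Equal (Var U) (Var W))
       Skip
       (Write Pos (Var U) (Var PW) ;;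
        Write Vert (Var PU) (Var W) ;;
        Write Pos (Var W) (Var PU) ;;
        Write Vert (Var PW) (Var U)) ;;
     Write Bin (Var DU) (Add (Read Bin (Var DU)) (Const 1)) ;;
     Write Deg (Var U) (Sub (Read Deg (Var U)) (Const 1))"

definition kshell_step :: com where
  "kshell_step =
     If (Equal (Var J) (Read Idx (Add (Var V) (Const 1))))
       (Assign I (Add (Var I) (Const 1)) ;;
        Assign V (Read Vert (Var I)) ;;
        Assign J (Read Idx (Var V)))
       (Assign U (Read Edges (Var J)) ;;
        If (Less (Read Deg (Var V)) (Read Deg (Var U))) kshell_decrement Skip ;;
        Assign J (Add (Var J) (Const 1)))"

definition kshell :: "nat \<Rightarrow> nat \<Rightarrow> com" where
  "kshell n m =
     kshell_init n ;;
     kshell_degrees n ;;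
     kshell_bins n ;;
     kshell_sort n ;;
     Assign I (Const 1) ;;
     Assign V (Read Vert (Var I)) ;;
     Assign J (Read Idx (Var V)) ;;
     For Iter 1 (n + m - 1) kshell_step"

text \<open>
  The array \<open>Bin\<close> is addressed at \<open>0, \<dots>, n\<close>: entry 0 is used if there is a vertex without outgoing
  edges, and the prefix sums run up to entry \<open>n\<close>.
\<close>
fun array_size :: "nat \<Rightarrow> nat \<Rightarrow> arr \<Rightarrow> nat" where
  "array_size n m Edges = m + 1"
| "array_size n m Bin = n + 1"
| "array_size n m _ = n"

definition kshell_time ::
  "(nat \<Rightarrow> nat) \<Rightarrow> (nat \<Rightarrow> nat) \<Rightarrow> sorter \<Rightarrow> nat \<Rightarrow> nat \<Rightarrow> state \<Rightarrow> nat"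
where
  "kshell_time f sc srt n m s =
     snd (exec (\<lambda>A. f (array_size n m A)) sc srt (kshell n m) True s)"

text \<open>
  \<open>adj u\<close> is the adjacency list of \<open>u\<close>, in any order. The entry \<open>m + 1\<close> of \<open>edges\<close> is the empty
  element, whose content is irrelevant.
\<close>
definition edgelist_rep ::
  "nat pair_pre_digraph \<Rightarrow> nat \<Rightarrow> nat \<Rightarrow> (nat \<Rightarrow> nat) \<Rightarrow> (nat \<Rightarrow> nat) \<Rightarrow> bool"
where
  "edgelist_rep G n m edges idx \<longleftrightarrow>
     pair_fin_digraph G \<and> pverts G = {1..n} \<and> card (parcs G) = m \<and>
     (\<exists>adj :: nat \<Rightarrow> nat list.
        (\<forall>u\<in>{1..n}. distinct (adj u) \<and> set (adj u) = {w. (u, w) \<in> parcs G}) \<and>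
        map edges [1..<m + 1] = concat (map adj [1..<n + 1]) \<and>
        (\<forall>u\<in>{1..n}. idx u =
           (if adj u \<noteq> [] then 1 + length (concat (map adj [1..<u]))
            else if u \<noteq> n then idx (u + 1)
            else m + 1)) \<and>
        idx (n + 1) = m + 1)"

end

theory Submission
  imports Defs
begin

text \<open>
  Both branches of every conditional are executed and the loop bounds are public, so the number of
  primitive operations depends on the command alone, not on the state. It is a static cost, which
  for the protocol consists of at most \<open>n\<close> or \<open>n + m - 1\<close> repetitions of loop bodies that make
  boundedly many array accesses. Since \<open>f (k + 1) = O(f k)\<close>, the allocated lengths \<open>n + 1\<close> and
  \<open>m + 1\<close> may be replaced by \<open>n\<close> and \<open>m\<close>.
\<close>

primrec cost_com :: "(arr \<Rightarrow> nat) \<Rightarrow> (nat \<Rightarrow> nat) \<Rightarrow> com \<Rightarrow> nat" where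
  "cost_com ac sc Skip = 0"
| "cost_com ac sc (Assign x e) = cost_expr ac e"
| "cost_com ac sc (Write A i e) = cost_expr ac i + cost_expr ac e + ac A"
| "cost_com ac sc (Seq c1 c2) = cost_com ac sc c1 + cost_com ac sc c2"
| "cost_com ac sc (If b c1 c2) = cost_test ac b + cost_com ac sc c1 + cost_com ac sc c2"
| "cost_com ac sc (For x a b c) = (b + 1 - a) * (cost_com ac sc c + 2)"
| "cost_com ac sc (Sort k A K) = sc k"

text \<open>Loops thread state and cost together through a fold. As the increment is the same
  \<open>d\<close> in every state, the cost can be read off without knowing the intermediate
  states.\<close>

lemma snd_fold_add_const:
  assumes "\<And>k s t. snd (g k (s, t)) = t + d"
  shows "snd (fold g ks (s, t)) = t + length ks * d"
proof (induction ks arbitrary: s t)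
  case (Cons k ks)
  obtain s' t' where "g k (s, t) = (s', t')"
    by fastforce
  with assms[of k s t] Cons show ?case
    by simp
qed simp

lemma snd_exec: "snd (exec ac sc srt c act s) = cost_com ac sc c"
\<comment> \<open>The flag and the state must vary: the branches of an \<open>If\<close> run under
  different flags, and the later part of a sequence starts in a changed state.\<close>
proof (induction c arbitrary: act s)
  case (For x a b c)
  then show ?case
    unfolding exec.simps
    by (subst snd_fold_add_const[where d = "cost_com ac sc c + 2"])
       (simp_all add: case_prod_beta del: upt_Suc)
qed (simp_all add: case_prod_beta Let_def)

text \<open>Here \<open>x\<close> bounds every access cost, and \<open>x \<ge> 1\<close> lets it
  absorb the arithmetic operations and loop overheads too. The constant 100 is generous: the parts
  below add up to 72 for \<open>n * x\<close> and 40 for \<open>m * x\<close>.\<close>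

lemma cost_kshell_le:
  assumes "n \<ge> 1" and "ac Deg \<le> x" "ac Bin \<le> x" "ac Vert \<le> x" "ac Pos \<le> x" "ac Edges \<le> x"
    "ac Idx \<le> x" and "x \<ge> 1"
  shows "cost_com ac sc (kshell n m) \<le> 100 * ((n + m) * x) + sc n"
proof -
  have init: "cost_com ac sc (kshell_init n) \<le> n * (9 * x)"
  proof -
    have "(n - 1) * (ac Bin + 2) \<le> n * (3 * x)" "n * (ac Deg + 2) \<le> n * (3 * x)"
      "n * (ac Vert + 2) \<le> n * (3 * x)"
      using assms by (intro mult_le_mono; simp)+
    then show ?thesis
      by (simp add: kshell_init_def)
  qed
  have degrees: "cost_com ac sc (kshell_degrees n) \<le> n * (12 * x)"
    unfolding kshell_degrees_def cost_com.simps
    using assms by (intro mult_le_mono) simp_all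
  have bins: "cost_com ac sc (kshell_bins n) \<le> n * (5 * x)"
  proof -
    have "n * (2 * ac Bin + 3) \<le> n * (5 * x)"
      using assms by (intro mult_le_mono) simp_all
    then show ?thesis
      by (simp add: kshell_bins_def algebra_simps)
  qed
  have sort: "cost_com ac sc (kshell_sort n) \<le> n * (4 * x) + sc n"
  proof -
    have "n * (ac Vert + ac Pos + 2) \<le> n * (4 * x)"
      using assms by (intro mult_le_mono) simp_all
    then show ?thesis
      by (simp add: kshell_sort_def)
  qed
  \<comment> \<open>With both branches counted, one iteration makes 18 array accesses and 10 other
    operations, including the 2 for the loop counter.\<close>
  have "cost_com ac sc kshell_step + 2 \<le> 40 * x"
    using assms by (simp add: kshell_step_def kshell_decrement_def)
  then have loop: "cost_com ac sc (For Iter 1 (n + m - 1) kshell_step) \<le> (n + m) * (40 * x)"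
    unfolding cost_com.simps by (intro mult_le_mono) simp_all
  have "ac Vert \<le> n * x" "ac Idx \<le> n * x"
    using assms mult_le_mono[of 1 n] by fastforce+
  with init degrees bins sort loop show ?thesis
    by (simp add: kshell_def algebra_simps del: cost_com.simps(6))
qed

text \<open>The theorem needs one constant for all sizes, not just large ones. The finitely many
  arguments below the threshold are covered by the sum \<open>d\<close> of their values.\<close>

lemma bigo_imp_le_affine:
  fixes g h :: "nat \<Rightarrow> real"
  assumes "g \<in> O(h)"
  obtains c d where "c > 0" "d \<ge> 0" "\<And>k. g k \<le> c * \<bar>h k\<bar> + d"
proof -
  obtain c N where c: "c > 0" "\<And>k. k \<ge> N \<Longrightarrow> \<bar>g k\<bar> \<le> c * \<bar>h k\<bar>"
    using assms by (auto simp: bigo_def eventually_at_top_linorder)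
  define d where "d = (\<Sum>k<N. \<bar>g k\<bar>)"
  have "g k \<le> c * \<bar>h k\<bar> + d" for k
  proof (cases "k < N")
    case True
    then have "\<bar>g k\<bar> \<le> d"
      unfolding d_def by (intro member_le_sum) auto
    moreover have "0 \<le> c * \<bar>h k\<bar>"
      using c(1) by simp
    ultimately show ?thesis
      by linarith
  next
    case False
    moreover have "d \<ge> 0"
      unfolding d_def by (intro sum_nonneg) simp
    ultimately show ?thesis
      using c(2)[of k] by force
  qed
  moreover have "d \<ge> 0"
    unfolding d_def by (intro sum_nonneg) simp
  ultimately show thesis
    using that c(1) by blast
qed

theorem theorem3:
  fixes f sc :: "nat \<Rightarrow> nat" and srt :: sorter
  assumes "\<And>k. k \<ge> 1 \<Longrightarrow> f k \<ge> 1"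
    and "(\<lambda>k. real (f (k + 1))) \<in> O(\<lambda>k. real (f k))"
    and "is_sorter srt"
    and "(\<lambda>k. real (sc k)) \<in> O(\<lambda>k. real k * (log 2 (real k))\<^sup>2)"
  shows "\<exists>C>0. \<forall>G n m s. n \<ge> 1 \<longrightarrow> edgelist_rep G n m (mem s Edges) (mem s Idx) \<longrightarrow>
           real (kshell_time f sc srt n m s)
             \<le> C * (real (n + m) * (real (f n) + real (f m)) + real n * (log 2 (real n))\<^sup>2)"
proof -
  obtain a b where a: "a > 0" and b: "b \<ge> 0" and f: "\<And>k. real (f (k + 1)) \<le> a * \<bar>real (f k)\<bar> + b"
    using bigo_imp_le_affine[OF assms(2)] by blast
  obtain c d where c: "c > 0" and d: "d \<ge> 0"
    and sc: "\<And>k. real (sc k) \<le> c * \<bar>real k * (log 2 (real k))\<^sup>2\<bar> + d"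
    using bigo_imp_le_affine[OF assms(4)] by blast
  \<comment> \<open>The first summand pays for array accesses and arithmetic, \<open>c\<close> and
    \<open>d\<close> for sorting.\<close>
  define C where "C = 100 * (1 + a + 2 * b) + c + d"
  have "real (kshell_time f sc srt n m s)
      \<le> C * (real (n + m) * (real (f n) + real (f m)) + real n * (log 2 (real n))\<^sup>2)"
    if n: "n \<ge> 1" for n m s
  proof -
    define P where "P = real (n + m) * (real (f n) + real (f m))"
    define L where "L = real n * (log 2 (real n))\<^sup>2"
    define x where "x = f n + f (n + 1) + f (m + 1)"
    have fn: "1 \<le> real (f n)"
      using assms(1)[OF n] by simp
    have "real x \<le> real (f n) + (a * real (f n) + b) + (a * real (f m) + b)"
      using f[of n] f[of m] by (simp add: x_def)
    \<comment> \<open>Both copies of \<open>b\<close> are charged to \<open>f n \<ge> 1\<close>,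
      since \<open>f m\<close> may be 0 when \<open>m = 0\<close>.\<close>
    also have "\<dots> \<le> (1 + a + 2 * b) * (real (f n) + real (f m))"
      using mult_left_mono[OF fn b] mult_nonneg_nonneg[OF b, of "real (f m)"]
      by (simp add: algebra_simps)
    finally have "real (n + m) * real x \<le> (1 + a + 2 * b) * P"
      using mult_left_mono[of "real x" _ "real (n + m)"] by (fastforce simp: P_def mult_ac)
    moreover have "real (sc n) \<le> c * L + d"
      using sc[of n] by (simp add: L_def abs_mult)
    moreover have "kshell_time f sc srt n m s \<le> 100 * ((n + m) * x) + sc n"
      unfolding kshell_time_def snd_exec
      using n assms(1)[OF n] by (intro cost_kshell_le) (simp_all add: x_def)
    then have "real (kshell_time f sc srt n m s) \<le> 100 * (real (n + m) * real x) + real (sc n)"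
      by (metis of_nat_le_iff of_nat_add of_nat_mult of_nat_numeral)
    ultimately have "real (kshell_time f sc srt n m s) \<le> 100 * (1 + a + 2 * b) * P + c * L + d"
      by linarith
    also have "\<dots> \<le> C * (P + L)"
    proof -
      \<comment> \<open>The additive \<open>d\<close> must be absorbed by \<open>P\<close>, because
        \<open>L\<close> vanishes at \<open>n = 1\<close>.\<close>
      have "1 * 1 \<le> P"
        unfolding P_def using n fn by (intro mult_mono) auto
      then have "d \<le> d * P" "0 \<le> c * P"
        using d c mult_left_mono[of 1 P d] by simp_all
      moreover have "0 \<le> (100 * (1 + a + 2 * b) + d) * L"
        unfolding L_def using a b d by simp
      ultimately show ?thesis
        by (simp add: C_def algebra_simps)
    qed
    finally show ?thesis
      by (simp only: P_def L_def)
  qed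
  moreover have "C > 0"
    unfolding C_def using a b c d by simp
  ultimately show ?thesis
    by blast
qed

end
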